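(* For every Dyck path $a$, $$f(uad)=\sum_{s\ge a}\mathrm{v}(a,s)\,I(s),$$ where the sum is over all Dyck paths $s$ with $|s|=|a|$ and $s\ge a$.
   Context: A (binary) path of length $|P|=n\ge 0$ is a word $P=p_1\cdots p_n$ in the letters $u$ (upstep $(1,1)$) and $d$ (downstep $(1,-1)$), viewed as a lattice path starting at the origin $(0,0)$; $\varepsilon$ is the empty path. $\mathcal{P}_n$ is the set of paths of length $n$. The height of a point is its $y$-coordinate, and $h_i(P)$ is the height of the $i$-th point (after $i$ steps). $\mathcal{P}_n$ is partially ordered by $P\le Q$ iff $h_i(P)\le h_i(Q)$ for all $1\le i\le n$; this is a finite distributive lattice with maximum $\mathbf{1}_n=u^n$. A valley of $P$ is the last point of a maximal run of consecutive $d$'s: it is either the middle point of an occurrence of $du$, or the final point of $P$ if $P$ ends with $d$. Turning a valley into a peak means replacing the corresponding $du$ by $ud$, or replacing the final $d$ by $u$ if the valley is the final point. $Q$ covers $P$ iff $Q$ is obtained from $P$ by turning exactly one valley into a peak. An interval $[x,y]$ in a poset is small if $y$ is the join of some elements covering $x$. A $P-\mathbf{1}_n$ chain $P=P_0<P_1<\cdots<P_k=\mathbf{1}_n$ (of length $k$) in $\mathcal{P}_n$ has small intervals if for every $i\in\{1,\dots,k\}$ the path $P_i$ is obtained by (simultaneously) turning some valleys of $P_{i-1}$ into peaks. For $P\in\mathcal{P}_n$, $f(P)$ is the number of $P-\mathbf{1}_n$ chains with small intervals whose length is minimum among all $P-\mathbf{1}_n$ chains with small intervals (so $f(\mathbf{1}_n)=1$).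 A Dyck path is a path that starts and ends at the same height and lies weakly above this height. $\mathcal{D}$ is the set of all Dyck paths, including $\varepsilon$. For $a\in\mathcal{D}$, $\mathrm{hv}(a)$ is the height of the highest valley of $a$, with the convention $\mathrm{hv}(\varepsilon)=0$. A multichain of Dyck paths $\sigma_0\le\sigma_1\le\cdots\le\sigma_h$ (all of the same length), where $h=\mathrm{hv}(\sigma_0)$, is of type $\mathrm{v}$ iff for every $j\in\{1,\dots,h\}$ the paths $\sigma_j$ and $\sigma_{j-1}$ have the same valleys (as points) at every height $\le h-j$. For $a,b\in\mathcal{D}$ with $a\le b$, $\mathrm{v}(a,b)$ is the number of multichains of type $\mathrm{v}$ with $\sigma_0=a$ and $\sigma_h=b$, $h=\mathrm{hv}(a)$ (in particular $\mathrm{v}(\varepsilon,\varepsilon)=1$). For $a\in\mathcal{D}$, $I(a)=\bigl|[a,\,u^{|a|/2}d^{|a|/2}]\bigr|$, the number of paths $Q$ with $a\le Q\le u^{|a|/2}d^{|a|/2}$. *)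

theory Defs
  imports Main
begin

datatype step = U | D

type_synonym path = "step list"

primrec step_val :: "step \<Rightarrow> int" where
  "step_val U = 1"
| "step_val D = - 1"

definition height :: "path \<Rightarrow> nat \<Rightarrow> int" where
  "height P i = sum_list (map step_val (take i P))"

definition path_le :: "path \<Rightarrow> path \<Rightarrow> bool"  (infix "\<le>\<^sub>P" 50) where
  "P \<le>\<^sub>P Q \<longleftrightarrow> length P = length Q \<and> (\<forall>i\<in>{1..length P}. height P i \<le> height Q i)"

definition path_less :: "path \<Rightarrow> path \<Rightarrow> bool"  (infix "<\<^sub>P" 50) where
  "P <\<^sub>P Q \<longleftrightarrow> P \<le>\<^sub>P Q \<and> P \<noteq> Q"

text \<open>The \<open>i\<close>-th point of a path is the one reached after \<open>i\<close> steps, so the step into it is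
  \<open>P ! (i - 1)\<close> and the step out of it (if any) is \<open>P ! i\<close>. A final down-step ends in a valley.\<close>

definition valley_indices :: "path \<Rightarrow> nat set" where
  "valley_indices P =
     {i. 1 \<le> i \<and> i \<le> length P \<and> P ! (i - 1) = D \<and> (i = length P \<or> P ! i = U)}"

definition valleys :: "path \<Rightarrow> (nat \<times> int) set" where
  "valleys P = (\<lambda>i. (i, height P i)) ` valley_indices P"

text \<open>For \<open>S \<subseteq> valley_indices P\<close>, simultaneously turn the valleys with index in \<open>S\<close> into peaks:
  the step into such a point becomes \<open>U\<close> and the step out of it, if there is one, becomes \<open>D\<close>.
  Distinct valleys affect disjoint sets of steps.\<close>

definition turn_valleys :: "nat set \<Rightarrow> path \<Rightarrow> path" where
  "turn_valleys S P =
     map (\<lambda>k. if Suc k \<in> S then U else if k \<in> S then D else P ! k) [0..<length P]"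

text \<open>A chain \<open>P\<^sub>0 < \<dots> < P\<^sub>k\<close> is the list of its \<open>k + 1\<close> elements.\<close>

definition small_interval_chain :: "path \<Rightarrow> path list \<Rightarrow> bool" where
  "small_interval_chain P c \<longleftrightarrow>
     c \<noteq> [] \<and> hd c = P \<and> last c = replicate (length P) U \<and>
     sorted_wrt (<\<^sub>P) c \<and>
     (\<forall>i\<in>{1..<length c}. \<exists>S\<subseteq>valley_indices (c ! (i - 1)).
        c ! i = turn_valleys S (c ! (i - 1)))"

definition num_min_chains :: "path \<Rightarrow> nat" where
  "num_min_chains P =
     card {c. small_interval_chain P c \<and>
              (\<forall>c'. small_interval_chain P c' \<longrightarrow> length c \<le> length c')}"

definition dyck :: "path \<Rightarrow> bool" where
  "dyck a \<longleftrightarrow> height a (length a) = 0 \<and> (\<forall>i\<le>length a. 0 \<le> height a i)"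

text \<open>A nonempty Dyck path ends in a valley of height \<open>0\<close> and has no valley of negative height,
  so for Dyck paths the maximum exists and the conversion to \<^typ>\<open>nat\<close> is harmless.\<close>

definition hv :: "path \<Rightarrow> nat" where
  "hv a = (if a = [] then 0 else nat (Max (snd ` valleys a)))"

definition valleys_upto :: "path \<Rightarrow> int \<Rightarrow> (nat \<times> int) set" where
  "valleys_upto P m = {p \<in> valleys P. snd p \<le> m}"

definition type_v :: "path list \<Rightarrow> bool" where
  "type_v \<sigma> \<longleftrightarrow>
     length \<sigma> = Suc (hv (\<sigma> ! 0)) \<and> (\<forall>s\<in>set \<sigma>. dyck s) \<and> sorted_wrt (\<le>\<^sub>P) \<sigma> \<and>
     (\<forall>j\<in>{1..hv (\<sigma> ! 0)}.
        valleys_upto (\<sigma> ! j) (int (hv (\<sigma> ! 0)) - int j) =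
        valleys_upto (\<sigma> ! (j - 1)) (int (hv (\<sigma> ! 0)) - int j))"

definition num_type_v :: "path \<Rightarrow> path \<Rightarrow> nat" where
  "num_type_v a b = card {\<sigma>. type_v \<sigma> \<and> hd \<sigma> = a \<and> last \<sigma> = b}"

definition num_above :: "path \<Rightarrow> nat" where
  "num_above a =
     card {Q. a \<le>\<^sub>P Q \<and>
              Q \<le>\<^sub>P replicate (length a div 2) U @ replicate (length a div 2) D}"

end

theory Submission
  imports Defs "HOL-Library.FuncSet"
begin

text \<open>Give each point of a path the cells \<open>(i, h)\<close> through which it can still be raised, where
  \<open>(i, h)\<close> stands for lifting the \<open>i\<close>-th point from height
  \<open>h - 2\<close> to height \<open>h\<close>. A multichain of paths from \<open>P\<close> to
  \<open>T\<close> is then the same as a labeling of the cells between \<open>P\<close> and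
  \<open>T\<close> by the time at which they are added, and the only condition on the labeling is that it
  is weakly increasing along the covering pairs \<open>(i, h)\<close>,
  \<open>(i \<plusminus> 1, h + 1)\<close> (\<open>bij_betw_labelings_multichains\<close>). A step
  of the multichain turns some valleys into peaks precisely when the cells it adds form an antichain, so
  chains with small intervals correspond to strictly increasing labelings
  (\<open>small_steps_iff_strict\<close>).

  Let \<open>P = u a d\<close> with \<open>n\<close> steps. The final point of \<open>P\<close> is a
  valley of height \<open>0\<close>, and the cells above it contain a zigzag with one cell for each
  height \<open>2, \<dots>, n\<close>; hence at least \<open>n - 1\<close> steps are required, and
  these suffice (\<open>num_min_chains_eq_card_strict_labelings\<close>). With exactly
  \<open>n - 1\<close> steps a cell \<open>(i, h)\<close> has label at most \<open>h - 1\<close>,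
  because a chain of \<open>n - h\<close> cells lies above it, and the label equals
  \<open>h - 1\<close> if \<open>i + h > n\<close>, because such a cell lies above the zigzag's
  bottom cell (\<open>strict_labelings_upper\<close>, \<open>strict_labelings_lower\<close>). What
  remains free is the labeling of the cells with \<open>i + h \<le> n\<close>, and these are, up to
  translation by \<open>(1, 1)\<close>, the cells between \<open>a\<close> and the highest Dyck path of
  its length. So \<open>f(u a d)\<close> counts strict labelings of the latter with labels in
  \<open>{1..h}\<close> on \<open>(i, h)\<close>.

  Covering a cell increases \<open>h\<close> by one, so adding \<open>hv a + 2 - h\<close> to the
  label of \<open>(i, h)\<close> turns a strict labeling into a weak one, and the bound \<open>1\<close>
  on the labels into the bound \<open>hv a + 3 - h\<close>
  (\<open>card_strict_labelings_elevated\<close>). Read as a multichain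
  \<open>a = \<sigma>\<^sub>0 \<le> \<dots> \<le> \<sigma>\<^sub>h \<le> Q \<le> u\<^sup>md\<^sup>m\<close>
  with \<open>h = hv a\<close>, the new bound says that \<open>\<sigma>\<^sub>j\<close> adds to
  \<open>a\<close> only cells of height at least \<open>h + 3 - j\<close>, that is, that
  \<open>\<sigma>\<^sub>j\<close> has the same valleys as \<open>a\<close> at every height at most
  \<open>h - j\<close> (\<open>valleys_upto_eq_iff\<close>). Such multichains are exactly a multichain
  of type \<open>v\<close> from \<open>a\<close> to some \<open>s\<close> followed by a path
  \<open>Q\<close> above \<open>s\<close>, which the right-hand side counts.\<close>

section \<open>Heights and the order on paths\<close>

lemma height_0 [simp]: "height P 0 = 0"
  by (simp add: height_def)

lemma height_Suc: "i < length P \<Longrightarrow> height P (Suc i) = height P i + step_val (P ! i)"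
  by (simp add: height_def take_Suc_conv_app_nth)

definition adj :: "nat \<Rightarrow> nat \<Rightarrow> bool" where
  "adj i j \<longleftrightarrow> j = Suc i \<or> i = Suc j"

lemma adj_sym: "adj i j \<Longrightarrow> adj j i"
  by (auto simp: adj_def)

lemma height_Suc_cases:
  "i < length P \<Longrightarrow> height P (Suc i) = height P i + 1 \<or> height P (Suc i) = height P i - 1"
  by (cases "P ! i") (auto simp: height_Suc)

lemma height_adj:
  assumes "adj i j" "i \<le> length P" "j \<le> length P"
  shows "height P j = height P i + 1 \<or> height P j = height P i - 1"
  using assms height_Suc_cases[of i P] height_Suc_cases[of j P] by (auto simp: adj_def)

lemma height_parity: "i \<le> length P \<Longrightarrow> even (height P i + int i)"
proof (induction i)
  case (Suc i)
  then show ?case using height_Suc_cases[of i P] by auto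
qed simp

lemma height_le_index: "i \<le> length P \<Longrightarrow> height P i \<le> int i"
proof (induction i)
  case (Suc i)
  then show ?case using height_Suc_cases[of i P] by auto
qed simp

lemma height_descent: "i + d \<le> length P \<Longrightarrow> height P i \<le> height P (i + d) + int d"
proof (induction d)
  case (Suc d)
  then show ?case using height_Suc_cases[of "i + d" P] by auto
qed simp

lemma step_eq_U_iff: "i < length P \<Longrightarrow> P ! i = U \<longleftrightarrow> height P (Suc i) = height P i + 1"
  by (cases "P ! i") (auto simp: height_Suc)

lemma step_eq_D_iff: "i < length P \<Longrightarrow> P ! i = D \<longleftrightarrow> height P (Suc i) = height P i - 1"
  by (cases "P ! i") (auto simp: height_Suc)

lemma path_eqI:
  assumes "length P = length Q" "\<And>i. i \<le> length P \<Longrightarrow> height P i = height Q i"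
  shows "P = Q"
proof (rule nth_equalityI[OF assms(1)])
  fix i assume i: "i < length P"
  show "P ! i = Q ! i"
    using step_eq_U_iff[of i P] step_eq_U_iff[of i Q] assms i
    by (cases "P ! i"; cases "Q ! i") auto
qed

definition path_of_heights :: "nat \<Rightarrow> (nat \<Rightarrow> int) \<Rightarrow> path" where
  "path_of_heights n f = map (\<lambda>i. if f i < f (Suc i) then U else D) [0..<n]"

lemma length_path_of_heights [simp]: "length (path_of_heights n f) = n"
  by (simp add: path_of_heights_def)

lemma height_path_of_heights:
  assumes "f 0 = 0" "\<And>i. i < n \<Longrightarrow> f (Suc i) = f i + 1 \<or> f (Suc i) = f i - 1" "i \<le> n"
  shows "height (path_of_heights n f) i = f i"
  using assms(3)
proof (induction i)
  case 0
  then show ?case using assms(1) by simp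
next
  case (Suc i)
  then show ?case using assms(2)[of i] by (auto simp: height_Suc path_of_heights_def)
qed

lemma path_le_iff:
  "P \<le>\<^sub>P Q \<longleftrightarrow> length P = length Q \<and> (\<forall>i\<le>length P. height P i \<le> height Q i)"
proof -
  have "height P i \<le> height Q i" if "\<forall>i\<in>{1..length P}. height P i \<le> height Q i" "i \<le> length P" for i
    using that by (cases i) auto
  then show ?thesis by (auto simp: path_le_def)
qed

lemma path_le_refl [simp]: "P \<le>\<^sub>P P"
  by (simp add: path_le_iff)

lemma path_le_trans: "P \<le>\<^sub>P Q \<Longrightarrow> Q \<le>\<^sub>P R \<Longrightarrow> P \<le>\<^sub>P R"
  by (fastforce simp: path_le_iff)

lemma path_le_antisym: "P \<le>\<^sub>P Q \<Longrightarrow> Q \<le>\<^sub>P P \<Longrightarrow> P = Q"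
  by (rule path_eqI) (auto simp: path_le_iff intro: antisym)

lemma valley_indices_iff:
  "i \<in> valley_indices P \<longleftrightarrow>
     1 \<le> i \<and> i \<le> length P \<and> (\<forall>j\<le>length P. adj i j \<longrightarrow> height P j = height P i + 1)"
proof (cases i)
  case (Suc k)
  have "(\<forall>j\<le>length P. adj i j \<longrightarrow> height P j = height P i + 1) \<longleftrightarrow>
      height P k = height P i + 1 \<and> (i < length P \<longrightarrow> height P (Suc i) = height P i + 1)"
    if "i \<le> length P"
  proof -
    have "adj i j \<longleftrightarrow> j = k \<or> j = Suc i" for j using Suc by (auto simp: adj_def)
    then show ?thesis using that Suc by (metis Suc_leD Suc_leI less_eq_Suc_le)
  qed
  moreover have "P ! k = D \<longleftrightarrow> height P k = height P i + 1" if "i \<le> length P"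
    using step_eq_D_iff[of k P] that Suc by auto
  ultimately show ?thesis
    using step_eq_U_iff[of i P] Suc unfolding valley_indices_def by (cases "i = length P") auto
qed (simp add: valley_indices_def)

section \<open>Cells between two paths\<close>

text \<open>\<open>(i, h)\<close> represents the move that raises the \<open>i\<close>-th point from height
  \<open>h - 2\<close> to height \<open>h\<close>; the parity condition singles out the heights that
  the \<open>i\<close>-th point of a path can have.\<close>

definition cells :: "path \<Rightarrow> path \<Rightarrow> (nat \<times> int) set" where
  "cells P T = {(i, h). i \<le> length P \<and> even (h + int i) \<and> height P i < h \<and> h \<le> height T i}"

lemma cells_iff:
  "(i, h) \<in> cells P T \<longleftrightarrow> i \<le> length P \<and> even (h + int i) \<and> height P i < h \<and> h \<le> height T i"
  by (simp add: cells_def)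

text \<open>The height of \<open>Q\<close> at a point where it exceeds \<open>P\<close> is itself the height of a
  cell, so comparing paths above \<open>P\<close> reduces to comparing the sets of cells below them.\<close>

lemma path_le_by_cells:
  assumes "P \<le>\<^sub>P Q" "P \<le>\<^sub>P R" "Q \<le>\<^sub>P T"
    and "\<And>i h. (i, h) \<in> cells P T \<Longrightarrow> h \<le> height Q i \<Longrightarrow> h \<le> height R i"
  shows "Q \<le>\<^sub>P R"
  unfolding path_le_iff
proof (intro conjI allI impI)
  show "length Q = length R" using assms by (auto simp: path_le_iff)
  fix i assume i: "i \<le> length Q"
  show "height Q i \<le> height R i"
  proof (cases "height Q i \<le> height P i")
    case True
    then show ?thesis using assms(1,2) i by (auto simp: path_le_iff intro: order_trans)
  next
    case False
    then have "(i, height Q i) \<in> cells P T"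
      using assms(1,3) i height_parity[of i Q] by (auto simp: path_le_iff cells_iff)
    then show ?thesis using assms(4) by blast
  qed
qed

lemma cell_index_pos: "(i, h) \<in> cells P T \<Longrightarrow> 1 \<le> i"
  by (cases i) (auto simp: cells_iff)

lemma cell_height_ge: "(i, h) \<in> cells P T \<Longrightarrow> height P i + 2 \<le> h"
  using height_parity[of i P] by (cases "h = height P i + 1") (auto simp: cells_iff)

text \<open>A cell fails to cover another one only if it rests directly on a valley of \<open>P\<close>: if a
  neighbour of the point \<open>i\<close> lies below \<open>h - 1\<close> in \<open>P\<close>, then it
  has to be raised to \<open>h - 1\<close> first, and \<open>T\<close> does so since neighbouring
  heights of \<open>T\<close> differ by one.\<close>

lemma lower_cell:
  assumes le: "P \<le>\<^sub>P T" and cell: "(i, h) \<in> cells P T"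
  shows "(i \<in> valley_indices P \<and> h = height P i + 2) \<or> (\<exists>j. adj i j \<and> (j, h - 1) \<in> cells P T)"
proof (rule ccontr)
  assume neg: "\<not> ?thesis"
  have i: "1 \<le> i" "i \<le> length P" "even (h + int i)" "h \<le> height T i" "length T = length P"
    using cell cell_index_pos[OF cell] le by (auto simp: cells_iff path_le_iff)
  have nb: "height P j = height P i + 1 \<and> h \<le> height P i + 2" if "adj i j" "j \<le> length P" for j
  proof -
    have "even (h - 1 + int j)" using that i by (auto simp: adj_def)
    moreover have "h - 1 \<le> height T j" using height_adj[of i j T] that i by auto
    ultimately have "\<not> height P j < h - 1" using neg that by (auto simp: cells_iff)
    then show ?thesis using height_adj[of i j P] that i cell_height_ge[OF cell] by auto
  qed
  have "adj i (i - 1)" "i - 1 \<le> length P" using i by (auto simp: adj_def)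
  then have "h = height P i + 2" using nb cell_height_ge[OF cell] by fastforce
  moreover have "i \<in> valley_indices P" using nb i by (auto simp: valley_indices_iff)
  ultimately show False using neg by blast
qed

section \<open>Multichains as labelings of cells\<close>

definition multichains :: "path \<Rightarrow> path \<Rightarrow> nat \<Rightarrow> path list set" where
  "multichains P T k = {c. length c = Suc k \<and> c ! 0 = P \<and> c ! k = T \<and> (\<forall>t<k. c ! t \<le>\<^sub>P c ! Suc t)}"

lemma multichains_mono:
  assumes "c \<in> multichains P T k" "s \<le> t" "t \<le> k"
  shows "c ! s \<le>\<^sub>P c ! t"
  using assms(2,3)
proof (induction t rule: dec_induct)
  case (step t)
  then show ?case using assms(1) path_le_trans by (auto simp: multichains_def)
qed simp

lemma multichains_between:
  assumes "c \<in> multichains P T k" "t \<le> k"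
  shows "P \<le>\<^sub>P c ! t" "c ! t \<le>\<^sub>P T"
  using multichains_mono[OF assms(1), of 0 t] multichains_mono[OF assms(1), of t k] assms
  by (auto simp: multichains_def)

definition labelings :: "path \<Rightarrow> path \<Rightarrow> nat \<Rightarrow> (nat \<times> int \<Rightarrow> int) set" where
  "labelings P T k = {l \<in> cells P T \<rightarrow>\<^sub>E {1..int k}.
     \<forall>i j h. adj i j \<longrightarrow> (i, h) \<in> cells P T \<longrightarrow> (j, h + 1) \<in> cells P T \<longrightarrow> l (i, h) \<le> l (j, h + 1)}"

lemma labelingsI:
  assumes "l \<in> extensional (cells P T)"
    and "\<And>i h. (i, h) \<in> cells P T \<Longrightarrow> 1 \<le> l (i, h)"
    and "\<And>i h. (i, h) \<in> cells P T \<Longrightarrow> l (i, h) \<le> int k"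
    and "\<And>i j h. adj i j \<Longrightarrow> (i, h) \<in> cells P T \<Longrightarrow> (j, h + 1) \<in> cells P T \<Longrightarrow>
      l (i, h) \<le> l (j, h + 1)"
  shows "l \<in> labelings P T k"
  using assms by (auto simp: labelings_def PiE_iff)

lemma labelings_range: "l \<in> labelings P T k \<Longrightarrow> x \<in> cells P T \<Longrightarrow> 1 \<le> l x \<and> l x \<le> int k"
  unfolding labelings_def by (cases x) (auto dest!: PiE_mem)

lemma labelings_mono:
  "l \<in> labelings P T k \<Longrightarrow> adj i j \<Longrightarrow> (i, h) \<in> cells P T \<Longrightarrow> (j, h + 1) \<in> cells P T \<Longrightarrow>
    l (i, h) \<le> l (j, h + 1)"
  by (auto simp: labelings_def)

text \<open>Between two consecutive cells of a column there is always a cell in the column to the left, so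
  monotonicity within columns follows from monotonicity between neighbouring columns.\<close>

lemma labelings_column_mono:
  assumes l: "l \<in> labelings P T k" and le: "P \<le>\<^sub>P T"
    and "(i, h) \<in> cells P T" "(i, h') \<in> cells P T" "h \<le> h'"
  shows "l (i, h) \<le> l (i, h')"
proof -
  have "l (i, h) \<le> l (i, h + 2 * int m)" if "(i, h + 2 * int m) \<in> cells P T" for m
    using that
  proof (induction m)
    case (Suc m)
    define g where "g = h + 2 * int m"
    have g2: "(i, g + 1 + 1) \<in> cells P T" using Suc.prems by (simp add: g_def algebra_simps)
    have g0: "(i, g) \<in> cells P T"
      using g2 assms(3) by (auto simp: cells_iff g_def)
    have i: "1 \<le> i" "i \<le> length P" using cell_index_pos[OF g2] g2 by (auto simp: cells_iff)
    have a: "adj i (i - 1)" "adj (i - 1) i" using i by (auto simp: adj_def)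
    have g1: "(i - 1, g + 1) \<in> cells P T"
    proof -
      have "length T = length P" using le by (simp add: path_le_iff)
      then have "height P (i - 1) \<le> height P i + 1" "height T i - 1 \<le> height T (i - 1)"
        using height_adj[OF a(1), of P] height_adj[OF a(1), of T] i le_trans[OF diff_le_self i(2)]
        by auto
      then show ?thesis using g2 g0 i by (auto simp: cells_iff)
    qed
    have "l (i, h) \<le> l (i, g)" using Suc.IH g0 by (simp add: g_def)
    also have "\<dots> \<le> l (i - 1, g + 1)" using labelings_mono[OF l a(1) g0 g1] .
    also have "\<dots> \<le> l (i, g + 1 + 1)" using labelings_mono[OF l a(2) g1 g2] .
    finally show ?case by (simp add: g_def algebra_simps)
  qed simp
  moreover obtain m where "h' = h + 2 * int m"
  proof -
    have "even (h' - h)" using assms by (auto simp: cells_iff)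
    then obtain z where "h' - h = 2 * z" by blast
    then have "h' = h + 2 * int (nat z)" using assms(5) by simp
    then show ?thesis using that by blast
  qed
  ultimately show ?thesis using assms(4) by blast
qed

text \<open>The inverse construction: the path at time \<open>t\<close> lies just above the cells with label at most
  \<open>t\<close>.\<close>

definition snapshot_height :: "path \<Rightarrow> path \<Rightarrow> (nat \<times> int \<Rightarrow> int) \<Rightarrow> nat \<Rightarrow> nat \<Rightarrow> int" where
  "snapshot_height P T l t i = Max (insert (height P i) {h. (i, h) \<in> cells P T \<and> l (i, h) \<le> int t})"

definition snapshot :: "path \<Rightarrow> path \<Rightarrow> (nat \<times> int \<Rightarrow> int) \<Rightarrow> nat \<Rightarrow> path" where
  "snapshot P T l t = path_of_heights (length P) (snapshot_height P T l t)"

lemma finite_cell_column: "finite {h. (i, h) \<in> cells P T \<and> Q h}"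
  by (rule finite_subset[of _ "{height P i..height T i}"]) (auto simp: cells_iff)

lemma snapshot_height_cases:
  "snapshot_height P T l t i = height P i \<or>
   ((i, snapshot_height P T l t i) \<in> cells P T \<and> l (i, snapshot_height P T l t i) \<le> int t)"
  using Max_in[of "insert (height P i) {h. (i, h) \<in> cells P T \<and> l (i, h) \<le> int t}"]
    finite_cell_column[of i P T "\<lambda>h. l (i, h) \<le> int t"]
  unfolding snapshot_height_def by auto

lemma snapshot_height_ge:
  "height P i \<le> snapshot_height P T l t i"
  "(i, h) \<in> cells P T \<Longrightarrow> l (i, h) \<le> int t \<Longrightarrow> h \<le> snapshot_height P T l t i"
  unfolding snapshot_height_def using finite_cell_column[of i P T "\<lambda>h. l (i, h) \<le> int t"]
  by (auto intro!: Max_ge)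

lemma snapshot_height_parity:
  "i \<le> length P \<Longrightarrow> even (snapshot_height P T l t i + int i)"
  using snapshot_height_cases[of P T l t i] height_parity[of i P] by (auto simp: cells_iff)

text \<open>The cells present at time \<open>t\<close> are closed under passing to a covered cell. This makes
  neighbouring heights differ by at most one; by parity they differ by exactly one, so the heights come
  from a path.\<close>

lemma snapshot_height_adj_le:
  assumes l: "l \<in> labelings P T k" and le: "P \<le>\<^sub>P T"
    and ij: "adj i j" "i \<le> length P" "j \<le> length P"
  shows "snapshot_height P T l t j \<le> snapshot_height P T l t i + 1"
proof -
  define h where "h = snapshot_height P T l t j"
  consider "h = height P j" | "(j, h) \<in> cells P T" "l (j, h) \<le> int t"
    using snapshot_height_cases[of P T l t j] by (auto simp: h_def)
  then have "h \<le> snapshot_height P T l t i + 1"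
  proof cases
    case 1
    then show ?thesis
      using height_adj[of i j P] ij snapshot_height_ge(1)[of P i T l t] by auto
  next
    case 2
    show ?thesis
    proof (cases "h - 1 \<le> height P i")
      case True
      then show ?thesis using snapshot_height_ge(1)[of P i T l t] by auto
    next
      case False
      have "even (h - 1 + int i)" using 2 ij by (auto simp: cells_iff adj_def)
      then have c: "(i, h - 1) \<in> cells P T"
        using False 2 ij height_adj[of j i T] le by (auto simp: cells_iff path_le_iff adj_sym)
      have "l (i, h - 1) \<le> l (j, h)" using labelings_mono[OF l ij(1) c] 2 by simp
      then show ?thesis using snapshot_height_ge(2)[OF c, of l t] 2 by simp
    qed
  qed
  then show ?thesis by (simp add: h_def)
qed

lemma height_snapshot:
  assumes l: "l \<in> labelings P T k" and le: "P \<le>\<^sub>P T" and i: "i \<le> length P"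
  shows "height (snapshot P T l t) i = snapshot_height P T l t i"
  unfolding snapshot_def
proof (rule height_path_of_heights[OF _ _ i])
  show "snapshot_height P T l t 0 = 0"
    using snapshot_height_cases[of P T l t 0] by (auto simp: cells_iff)
  fix j assume j: "j < length P"
  have "snapshot_height P T l t (Suc j) \<le> snapshot_height P T l t j + 1"
    "snapshot_height P T l t j \<le> snapshot_height P T l t (Suc j) + 1"
    using snapshot_height_adj_le[OF l le] j by (auto simp: adj_def)
  moreover have "snapshot_height P T l t (Suc j) \<noteq> snapshot_height P T l t j"
    using snapshot_height_parity[of j P T l t] snapshot_height_parity[of "Suc j" P T l t] j by auto
  ultimately show "snapshot_height P T l t (Suc j) = snapshot_height P T l t j + 1 \<or>
      snapshot_height P T l t (Suc j) = snapshot_height P T l t j - 1" by linarith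
qed

lemma length_snapshot [simp]: "length (snapshot P T l t) = length P"
  by (simp add: snapshot_def)

lemma snapshot_between:
  assumes "l \<in> labelings P T k" "P \<le>\<^sub>P T"
  shows "P \<le>\<^sub>P snapshot P T l t" "snapshot P T l t \<le>\<^sub>P T"
  using assms height_snapshot[OF assms] snapshot_height_ge(1) snapshot_height_cases[of P T l t]
  unfolding path_le_iff by (auto simp: cells_iff) metis

lemma cell_below_snapshot_iff:
  assumes l: "l \<in> labelings P T k" and le: "P \<le>\<^sub>P T" and c: "(i, h) \<in> cells P T"
  shows "h \<le> height (snapshot P T l t) i \<longleftrightarrow> l (i, h) \<le> int t"
proof -
  define g where "g = snapshot_height P T l t i"
  have eq: "height (snapshot P T l t) i = g"
    using height_snapshot[OF l le] c by (auto simp: cells_iff g_def)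
  have "l (i, h) \<le> int t" if "h \<le> g"
  proof -
    have "(i, g) \<in> cells P T" "l (i, g) \<le> int t"
      using snapshot_height_cases[of P T l t i] that c by (auto simp: g_def cells_iff)
    then show ?thesis using labelings_column_mono[OF l le c _ that] by fastforce
  qed
  then show ?thesis using snapshot_height_ge(2)[OF c] by (auto simp: eq g_def)
qed

definition chain_of_labeling ::
  "path \<Rightarrow> path \<Rightarrow> nat \<Rightarrow> (nat \<times> int \<Rightarrow> int) \<Rightarrow> path list" where
  "chain_of_labeling P T k l = map (snapshot P T l) [0..<Suc k]"

lemma nth_chain_of_labeling [simp]: "t \<le> k \<Longrightarrow> chain_of_labeling P T k l ! t = snapshot P T l t"
  by (simp add: chain_of_labeling_def del: upt_Suc)

lemma chain_of_labeling_in_multichains: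
  assumes l: "l \<in> labelings P T k" and le: "P \<le>\<^sub>P T"
  shows "chain_of_labeling P T k l \<in> multichains P T k"
proof -
  note b = snapshot_between[OF l le] and c = cell_below_snapshot_iff[OF l le]
  note r = labelings_range[OF l]
  have "snapshot P T l 0 \<le>\<^sub>P P"
    by (rule path_le_by_cells[OF b(1) path_le_refl b(2)]) (use c r in fastforce)
  moreover have "T \<le>\<^sub>P snapshot P T l k"
    by (rule path_le_by_cells[OF le b(1) path_le_refl]) (use c r in fastforce)
  moreover have "snapshot P T l t \<le>\<^sub>P snapshot P T l (Suc t)" for t
    by (rule path_le_by_cells[OF b(1) b(1) b(2)]) (use c in fastforce)
  ultimately show ?thesis
    using b path_le_antisym by (auto simp: multichains_def simp del: upt_Suc) (auto simp: chain_of_labeling_def)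
qed

text \<open>Both directions rest on the threshold property \<open>cell_below_snapshot_iff\<close>: the label of a
  cell is the first time at which the path of the multichain lies above it.\<close>

lemma bij_betw_labelings_multichains:
  assumes le: "P \<le>\<^sub>P T"
  shows "bij_betw (chain_of_labeling P T k) (labelings P T k) (multichains P T k)"
  unfolding bij_betw_def
proof
  show "inj_on (chain_of_labeling P T k) (labelings P T k)"
  proof (rule inj_onI)
    fix l m assume l: "l \<in> labelings P T k" and m: "m \<in> labelings P T k"
      and eq: "chain_of_labeling P T k l = chain_of_labeling P T k m"
    have th: "l x \<le> int t \<longleftrightarrow> m x \<le> int t" if "x \<in> cells P T" "t \<le> k" for x t
    proof -
      obtain i h where x: "x = (i, h)" by (cases x)
      have "snapshot P T l t = snapshot P T m t"
        using arg_cong[OF eq, of "\<lambda>c. c ! t"] that by simp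
      then show ?thesis
        using cell_below_snapshot_iff[OF l le] cell_below_snapshot_iff[OF m le] that x by metis
    qed
    have "l x = m x" if "x \<in> cells P T" for x
      using th[OF that, of "nat (l x)"] th[OF that, of "nat (m x)"]
        labelings_range[OF l that] labelings_range[OF m that] by (simp add: nat_le_iff)
    then show "l = m"
      using l m by (intro PiE_ext[of l "cells P T" "\<lambda>_. {1..int k}"]) (auto simp: labelings_def)
  qed
  have "c \<in> chain_of_labeling P T k ` labelings P T k" if c: "c \<in> multichains P T k" for c
  proof
    define l where "l = restrict (\<lambda>(i, h). int (LEAST t. h \<le> height (c ! t) i)) (cells P T)"
    have th: "l (i, h) \<le> int t \<longleftrightarrow> h \<le> height (c ! t) i" if "(i, h) \<in> cells P T" "t \<le> k" for i h t
    proof -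
      define s where "s = (LEAST t. h \<le> height (c ! t) i)"
      have ck: "c ! k = T" using c by (simp add: multichains_def)
      have s: "h \<le> height (c ! s) i" unfolding s_def
        by (rule LeastI[of _ k]) (use that ck in \<open>auto simp: cells_iff\<close>)
      have "h \<le> height (c ! t) i" if "s \<le> t"
      proof -
        have "c ! s \<le>\<^sub>P c ! t" using multichains_mono[OF c that \<open>t \<le> k\<close>] .
        moreover have "i \<le> length (c ! s)"
          using multichains_between(1)[OF c, of s] \<open>(i, h) \<in> cells P T\<close> that \<open>t \<le> k\<close>
          by (auto simp: path_le_iff cells_iff)
        ultimately show ?thesis using s by (auto simp: path_le_iff intro: order_trans)
      qed
      moreover have "s \<le> t" if "h \<le> height (c ! t) i"
        unfolding s_def using that by (rule Least_le)
      ultimately show ?thesis using that by (auto simp: l_def s_def)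
    qed
    have rng: "1 \<le> l x \<and> l x \<le> int k" if "x \<in> cells P T" for x
    proof -
      obtain i h where x: "x = (i, h)" by (cases x)
      have "\<not> l x \<le> int 0" using th[of i h 0] that c x by (auto simp: multichains_def cells_iff)
      moreover have "l x \<le> int k" using th[of i h k] that c x by (auto simp: multichains_def cells_iff)
      ultimately show ?thesis by auto
    qed
    have "l (i, h) \<le> l (j, h + 1)"
      if ij: "adj i j" and i: "(i, h) \<in> cells P T" and j: "(j, h + 1) \<in> cells P T" for i j h
    proof -
      define t where "t = nat (l (j, h + 1))"
      have t: "l (j, h + 1) = int t" "t \<le> k" using rng[OF j] by (auto simp: t_def)
      have "h + 1 \<le> height (c ! t) j" using th[OF j t(2)] t by simp
      moreover have "length (c ! t) = length P"
        using multichains_between(1)[OF c t(2)] by (simp add: path_le_iff)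
      ultimately have "h \<le> height (c ! t) i"
        using height_adj[OF ij, of "c ! t"] i j by (auto simp: cells_iff)
      then show ?thesis using th[OF i t(2)] t by simp
    qed
    then show l: "l \<in> labelings P T k"
      using rng by (auto simp: labelings_def PiE_iff l_def extensional_def)
    show "c = chain_of_labeling P T k l"
    proof (rule nth_equalityI)
      show "length c = length (chain_of_labeling P T k l)"
        using c by (simp add: multichains_def chain_of_labeling_def)
      fix t assume "t < length c"
      then have t: "t \<le> k" using c by (simp add: multichains_def)
      note b = snapshot_between[OF l le, of t] and bc = multichains_between[OF c t]
      have e: "h \<le> height (c ! t) i \<longleftrightarrow> h \<le> height (snapshot P T l t) i"
        if "(i, h) \<in> cells P T" for i h
        using th[OF that t] cell_below_snapshot_iff[OF l le that] by simp
      have "c ! t = snapshot P T l t"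
        by (rule path_le_antisym; rule path_le_by_cells[OF _ _ _ ])
           (use b bc e in blast)+
      then show "c ! t = chain_of_labeling P T k l ! t" using t by simp
    qed
  qed
  then show "chain_of_labeling P T k ` labelings P T k = multichains P T k"
    using chain_of_labeling_in_multichains[OF _ le] by blast
qed

text \<open>The form in which the bijection is applied: a property of multichains is traded for a property of
  labelings.\<close>

lemma card_multichains_eq_card_labelings:
  assumes "P \<le>\<^sub>P T" "\<And>l. l \<in> labelings P T k \<Longrightarrow> F (chain_of_labeling P T k l) \<longleftrightarrow> G l"
  shows "card {c \<in> multichains P T k. F c} = card {l \<in> labelings P T k. G l}"
proof -
  note b = bij_betw_labelings_multichains[OF assms(1), of k]
  have "chain_of_labeling P T k ` {l \<in> labelings P T k. G l} =
      {c \<in> chain_of_labeling P T k ` labelings P T k. F c}"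
    using assms(2) by auto
  also have "\<dots> = {c \<in> multichains P T k. F c}"
    by (simp only: bij_betw_imp_surj_on[OF b])
  finally have "bij_betw (chain_of_labeling P T k) {l \<in> labelings P T k. G l} {c \<in> multichains P T k. F c}"
    by (rule bij_betw_subset[OF b Collect_restrict])
  from bij_betw_same_card[OF this] show ?thesis by (rule sym)
qed

section \<open>Small intervals and strict labelings\<close>

lemma length_turn_valleys [simp]: "length (turn_valleys S P) = length P"
  by (simp add: turn_valleys_def)

lemma height_turn_valleys:
  assumes S: "S \<subseteq> valley_indices P" and "i \<le> length P"
  shows "height (turn_valleys S P) i = height P i + (if i \<in> S then 2 else 0)"
  using assms(2)
proof (induction i)
  case 0
  then show ?case using S by (auto simp: valley_indices_def)
next
  case (Suc i)
  have "Suc i \<in> S \<Longrightarrow> P ! i = D" "i \<in> S \<Longrightarrow> P ! i = U"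
    using subsetD[OF S, of "Suc i"] subsetD[OF S, of i] Suc.prems
    by (auto simp: valley_indices_def)
  moreover have "\<not> (i \<in> S \<and> Suc i \<in> S)" using calculation by auto
  ultimately show ?case
    using Suc by (auto simp: height_Suc turn_valleys_def)
qed

definition small_step :: "path \<Rightarrow> path \<Rightarrow> bool" where
  "small_step P Q \<longleftrightarrow> (\<exists>S\<subseteq>valley_indices P. Q = turn_valleys S P)"

text \<open>Turning valleys raises no two neighbouring points, so the added cells are pairwise incomparable.
  Conversely, if no added cell covers an added one, then by \<open>lower_cell\<close> each of them rests
  on a valley of \<open>P\<close> and is the only added cell in its column.\<close>

lemma small_step_iff:
  assumes le: "P \<le>\<^sub>P Q"
  shows "small_step P Q \<longleftrightarrow> (\<forall>i j h. adj i j \<longrightarrow> (i, h) \<in> cells P Q \<longrightarrow> (j, h + 1) \<notin> cells P Q)"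
    (is "_ \<longleftrightarrow> ?antichain")
proof
  assume "small_step P Q"
  then obtain S where S: "S \<subseteq> valley_indices P" "Q = turn_valleys S P"
    by (auto simp: small_step_def)
  have cell: "i \<in> S \<and> h = height P i + 2" if "(i, h) \<in> cells P Q" for i h
    using that cell_height_ge[OF that] height_turn_valleys[OF S(1), of i] S(2)
    by (auto simp: cells_iff split: if_splits)
  show ?antichain
  proof (intro allI impI notI)
    fix i j h assume ij: "adj i j" and c: "(i, h) \<in> cells P Q" "(j, h + 1) \<in> cells P Q"
    then have "height P j = height P i + 1" "height P i = height P j + 1"
      using cell[OF c(1)] cell[OF c(2)] S(1) adj_sym[OF ij]
      by (auto simp: valley_indices_iff subset_iff)
    then show False by simp
  qed
next
  assume anti: ?antichain
  define S where "S = fst ` cells P Q"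
  have len: "length Q = length P" using le by (simp add: path_le_iff)
  have cell: "i \<in> valley_indices P \<and> h = height P i + 2" if c: "(i, h) \<in> cells P Q" for i h
    using lower_cell[OF le c] anti c adj_sym by fastforce
  have "S \<subseteq> valley_indices P" using cell by (auto simp: S_def)
  moreover have "Q = turn_valleys S P"
  proof (rule path_eqI)
    fix i assume i: "i \<le> length Q"
    show "height Q i = height (turn_valleys S P) i"
    proof (cases "height Q i = height P i")
      case True
      then have "i \<notin> S" by (auto simp: S_def cells_iff)
      then show ?thesis using True height_turn_valleys[OF calculation] i len by simp
    next
      case False
      then have c: "(i, height Q i) \<in> cells P Q"
        using i len le height_parity[of i Q] by (auto simp: cells_iff path_le_iff le_less)
      then have "i \<in> S" by (force simp: S_def)
      then show ?thesis using cell[OF c] height_turn_valleys[OF calculation] i len by simp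
    qed
  qed (simp add: len)
  ultimately show "small_step P Q" by (auto simp: small_step_def)
qed

definition strict_labelings :: "path \<Rightarrow> path \<Rightarrow> nat \<Rightarrow> (nat \<times> int \<Rightarrow> int) set" where
  "strict_labelings P T k = {l \<in> labelings P T k.
     \<forall>i j h. adj i j \<longrightarrow> (i, h) \<in> cells P T \<longrightarrow> (j, h + 1) \<in> cells P T \<longrightarrow> l (i, h) < l (j, h + 1)}"

lemma strict_labelingsD:
  assumes "l \<in> strict_labelings P T k"
  shows "l \<in> labelings P T k"
    and "adj i j \<Longrightarrow> (i, h) \<in> cells P T \<Longrightarrow> (j, h + 1) \<in> cells P T \<Longrightarrow> l (i, h) < l (j, h + 1)"
  using assms by (auto simp: strict_labelings_def)

lemma cells_snapshot_Suc:
  assumes l: "l \<in> labelings P T k" and le: "P \<le>\<^sub>P T"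
  shows "x \<in> cells (snapshot P T l t) (snapshot P T l (Suc t)) \<longleftrightarrow> x \<in> cells P T \<and> l x = int t + 1"
proof (cases x)
  case (Pair i h)
  show ?thesis
  proof (cases "(i, h) \<in> cells P T")
    case True
    then show ?thesis
      using cell_below_snapshot_iff[OF l le True, of t] cell_below_snapshot_iff[OF l le True, of "Suc t"]
      by (auto simp: Pair cells_iff)
  next
    case False
    then show ?thesis
      using snapshot_between(1)[OF l le, of t] snapshot_between(2)[OF l le, of "Suc t"]
      by (fastforce simp: Pair cells_iff path_le_iff)
  qed
qed

lemma small_steps_iff_strict:
  assumes l: "l \<in> labelings P T k" and le: "P \<le>\<^sub>P T"
  shows "(\<forall>t<k. small_step (chain_of_labeling P T k l ! t) (chain_of_labeling P T k l ! Suc t))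
    \<longleftrightarrow> l \<in> strict_labelings P T k" (is "?L \<longleftrightarrow> _")
proof -
  have sle: "snapshot P T l t \<le>\<^sub>P snapshot P T l (Suc t)" if "t < k" for t
    using chain_of_labeling_in_multichains[OF l le] that by (auto simp: multichains_def)
  have "?L \<longleftrightarrow> (\<forall>t<k. \<forall>i j h. adj i j \<longrightarrow> (i, h) \<in> cells P T \<longrightarrow> (j, h + 1) \<in> cells P T \<longrightarrow>
      \<not> (l (i, h) = int t + 1 \<and> l (j, h + 1) = int t + 1))"
    using small_step_iff[OF sle] by (simp add: cells_snapshot_Suc[OF l le]) blast
  also have "\<dots> \<longleftrightarrow> (\<forall>i j h. adj i j \<longrightarrow> (i, h) \<in> cells P T \<longrightarrow> (j, h + 1) \<in> cells P T \<longrightarrow>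
      l (i, h) \<noteq> l (j, h + 1))" (is "?A \<longleftrightarrow> ?B")
  proof
    assume A: ?A
    show ?B
    proof (intro allI impI notI)
      fix i j h assume ij: "adj i j" "(i, h) \<in> cells P T" "(j, h + 1) \<in> cells P T"
        and eq: "l (i, h) = l (j, h + 1)"
      have "nat (l (i, h) - 1) < k" "l (i, h) = int (nat (l (i, h) - 1)) + 1"
        using labelings_range[OF l ij(2)] by auto
      then show False using A ij eq by metis
    qed
  qed metis
  also have "\<dots> \<longleftrightarrow> l \<in> strict_labelings P T k"
    using l labelings_mono[OF l] unfolding strict_labelings_def
    by (auto simp: order_less_le)
  finally show ?thesis .
qed

text \<open>Strictness of the order is split off as the absence of idle steps, since a labeling need not use every
  label.\<close>

lemma small_interval_chain_iff:
  "small_interval_chain P c \<longleftrightarrow> (\<exists>k. c \<in> multichains P (replicate (length P) U) k \<and>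
     (\<forall>t<k. small_step (c ! t) (c ! Suc t)) \<and> (\<forall>t<k. c ! t \<noteq> c ! Suc t))"
proof -
  have tr: "transp (<\<^sub>P)"
    by (rule transpI) (metis path_le_antisym path_le_trans path_less_def)
  have steps: "(\<forall>i\<in>{1..<length c}. \<exists>S\<subseteq>valley_indices (c ! (i - 1)). c ! i = turn_valleys S (c ! (i - 1)))
      \<longleftrightarrow> (\<forall>t<k. small_step (c ! t) (c ! Suc t))" if k: "length c = Suc k" for k
  proof -
    have "{1..<length c} = Suc ` {..<k}" using k by (auto simp: image_iff gr0_conv_Suc Suc_le_eq)
    then show ?thesis by (simp add: small_step_def) auto
  qed
  have "small_interval_chain P c \<longleftrightarrow> (\<exists>k. length c = Suc k \<and> c ! 0 = P \<and>
      c ! k = replicate (length P) U \<and> (\<forall>t<k. c ! t <\<^sub>P c ! Suc t) \<and>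
      (\<forall>t<k. small_step (c ! t) (c ! Suc t)))"
  proof (cases "length c")
    case (Suc k)
    then have "c \<noteq> []" by auto
    then show ?thesis
      using Suc steps[OF Suc] unfolding small_interval_chain_def
      by (auto simp: hd_conv_nth last_conv_nth sorted_wrt_iff_nth_Suc_transp[OF tr])
  qed (auto simp: small_interval_chain_def)
  also have "\<dots> \<longleftrightarrow> (\<exists>k. c \<in> multichains P (replicate (length P) U) k \<and>
     (\<forall>t<k. small_step (c ! t) (c ! Suc t)) \<and> (\<forall>t<k. c ! t \<noteq> c ! Suc t))"
    by (rule arg_cong[of _ _ Ex]) (auto simp: multichains_def path_less_def fun_eq_iff)
  finally show ?thesis .
qed

section \<open>Shortest chains to the top\<close>

lemma height_replicate_U: "i \<le> n \<Longrightarrow> height (replicate n U) i = int i"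
  by (simp add: height_def sum_list_replicate min_def)

lemma path_le_replicate_U: "P \<le>\<^sub>P replicate (length P) U"
  by (simp add: path_le_iff height_replicate_U height_le_index)

lemma cells_top_iff:
  "(i, h) \<in> cells P (replicate (length P) U) \<longleftrightarrow>
     i \<le> length P \<and> even (h + int i) \<and> height P i < h \<and> h \<le> int i"
  by (auto simp: cells_iff height_replicate_U)

text \<open>A cell on or to the right of the antidiagonal through \<open>(n, 2)\<close>, where \<open>n\<close> is
  the length of \<open>P\<close>, is reached from \<open>(n, 2)\<close> by a chain with one cell for
  each height in between: going down, move to the right until the final column, then alternate between
  the last two columns.\<close>

lemma strict_labelings_lower:
  assumes l: "l \<in> strict_labelings P (replicate (length P) U) k"
    and end0: "height P (length P) = 0"
    and "(i, h) \<in> cells P (replicate (length P) U)" "int (length P) + 2 \<le> int i + h"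
  shows "h - 1 \<le> l (i, h)"
  using assms(3,4)
proof (induction "nat h" arbitrary: i h rule: less_induct)
  case less
  let ?n = "length P"
  have i: "i \<le> ?n" "even (h + int i)" "height P i < h" "h \<le> int i"
    using less.prems by (auto simp: cells_top_iff)
  have l1: "1 \<le> l (i, h)"
    using labelings_range[of l] l less.prems by (auto simp: strict_labelings_def)
  show ?case
  proof (cases "h = 2")
    case False
    define j where "j = (if i < ?n then Suc i else i - 1)"
    have n_even: "even ?n" using height_parity[of ?n P] end0 by simp
    have h: "2 \<le> h" using less.prems i by linarith
    have 4: "4 \<le> h" if "i = ?n" 
      using that i n_even h False by (cases "h = 3") auto
    have ij: "adj j i" "j \<le> ?n" using i h by (auto simp: j_def adj_def)
    have sum: "int ?n + 2 \<le> int j + (h - 1)"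
      using less.prems 4 i by (auto simp: j_def of_nat_diff)
    have "height P j \<le> int (?n - j)"
      using height_descent[of j "?n - j" P] ij end0 by simp
    then have c: "(j, h - 1) \<in> cells P (replicate ?n U)"
      using sum ij i by (auto simp: cells_top_iff j_def of_nat_diff)
    have "h - 2 \<le> l (j, h - 1)"
      using less.hyps[OF _ c sum] h by simp
    moreover have "l (j, h - 1) < l (i, h)"
      using strict_labelingsD(2)[OF l ij(1) c] less.prems(1) by simp
    ultimately show ?thesis by simp
  qed (use l1 in simp)
qed

text \<open>Dually, from any cell a chain leads up to \<open>(n, n)\<close>, along a diagonal and then alternating
  between the last two columns, and labels may not exceed \<open>n - 1\<close> at its top.\<close>

lemma strict_labelings_upper:
  assumes l: "l \<in> strict_labelings P (replicate (length P) U) (length P - 1)"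
    and end0: "height P (length P) = 0"
    and "(i, h) \<in> cells P (replicate (length P) U)"
  shows "l (i, h) \<le> h - 1"
  using assms(3)
proof (induction "nat (int (length P) - h)" arbitrary: i h rule: less_induct)
  case less
  let ?n = "length P"
  have i: "i \<le> ?n" "even (h + int i)" "height P i < h" "h \<le> int i"
    using less.prems by (auto simp: cells_top_iff)
  show ?case
  proof (cases "h = int ?n")
    case True
    then show ?thesis
      using labelings_range[OF strict_labelingsD(1)[OF l] less.prems]
        cell_index_pos[OF less.prems] i by (simp add: of_nat_diff)
  next
    case False
    define j where "j = (if i < ?n then Suc i else i - 1)"
    have i1: "1 \<le> i" using cell_index_pos[OF less.prems] .
    have ij: "adj i j" "j \<le> ?n" using i i1 by (auto simp: j_def adj_def)
    have "h \<noteq> int ?n - 1" if "i = ?n" using that i by auto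
    then have "h + 1 \<le> int j" using i False by (auto simp: j_def of_nat_diff)
    then have c: "(j, h + 1) \<in> cells P (replicate ?n U)"
      using ij i height_adj[OF ij(1), of P] i1 by (auto simp: cells_top_iff j_def of_nat_diff)
    have "l (j, h + 1) \<le> h"
      using less.hyps[OF _ c] i False by simp
    moreover have "l (i, h) < l (j, h + 1)"
      using strict_labelingsD(2)[OF l ij(1) less.prems c] .
    ultimately show ?thesis by simp
  qed
qed

text \<open>The minimal number of steps is \<open>n - 1\<close>: the bound on the label of \<open>(n, n)\<close>
  shows that fewer do not suffice, and the labeling \<open>(i, h) \<mapsto> h - 1\<close> attains
  it, where the hypothesis on the heights of \<open>P\<close> ensures \<open>h \<ge> 2\<close>. No step
  of a chain with \<open>n - 1\<close> small steps can be idle, since the forced labels already exhaust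
  \<open>{1..n - 1}\<close>.\<close>

lemma num_min_chains_eq_card_strict_labelings:
  assumes n0: "P \<noteq> []" and end0: "height P (length P) = 0"
    and pos: "\<And>i. 1 \<le> i \<Longrightarrow> i < length P \<Longrightarrow> 1 \<le> height P i"
  shows "num_min_chains P = card (strict_labelings P (replicate (length P) U) (length P - 1))"
proof -
  let ?n = "length P" and ?T = "replicate (length P) U"
  define k where "k = length P - 1"
  have n_even: "even ?n" using height_parity[of ?n P] end0 by simp
  have nk: "?n = Suc k" using n0 by (simp add: k_def)
  then have "k \<noteq> 0" using n_even by (intro notI) simp
  with nk have n: "?n = Suc k" "1 \<le> k" by auto
  note le = path_le_replicate_U[of P]
  \<comment> \<open>Each height from \<open>2\<close> to \<open>n\<close> occurs in a cell whose label is forced, in one of the last two columns.\<close>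
  have zig: "\<exists>i. (i, h) \<in> cells P ?T \<and> int ?n + 2 \<le> int i + h" if h: "2 \<le> h" "h \<le> int ?n" for h
  proof (cases "even h")
    case True
    then show ?thesis using h n_even end0 by (intro exI[of _ ?n]) (auto simp: cells_top_iff)
  next
    case False
    then have "h \<noteq> int ?n" "h \<noteq> 2" using n_even by auto
    then have "3 \<le> h" "h \<le> int k" using h n by auto
    moreover have "height P k \<le> 1" using height_descent[of k 1 P] end0 n by simp
    moreover have "even (h + int k)" using n_even False n by simp
    ultimately have "(k, h) \<in> cells P ?T" "int ?n + 2 \<le> int k + h"
      unfolding cells_top_iff using n by auto
    then show ?thesis by blast
  qed
  define C where "C = {c \<in> multichains P ?T k. \<forall>t<k. small_step (c ! t) (c ! Suc t)}"
  have labeling: "\<exists>l \<in> strict_labelings P ?T K. c = chain_of_labeling P ?T K l"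
    if c: "c \<in> multichains P ?T K" "\<forall>t<K. small_step (c ! t) (c ! Suc t)" for c K
  proof -
    have "c \<in> chain_of_labeling P ?T K ` labelings P ?T K"
      using c(1) bij_betw_imp_surj_on[OF bij_betw_labelings_multichains[OF le, of K]] by simp
    then obtain l where l: "l \<in> labelings P ?T K" "c = chain_of_labeling P ?T K l" by blast
    then have "l \<in> strict_labelings P ?T K" using c(2) small_steps_iff_strict[OF l(1) le] by simp
    then show ?thesis using l(2) by blast
  qed
  have min: "length P \<le> length c" if small: "small_interval_chain P c" for c
  proof -
    obtain K where K: "c \<in> multichains P ?T K" "\<forall>t<K. small_step (c ! t) (c ! Suc t)"
      using small by (auto simp: small_interval_chain_iff)
    obtain l where l: "l \<in> strict_labelings P ?T K" using labeling[OF K] by blast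
    obtain i where i: "(i, int ?n) \<in> cells P ?T" "int ?n + 2 \<le> int i + int ?n"
      using zig[of "int ?n"] n by auto
    have "int ?n - 1 \<le> l (i, int ?n)" using strict_labelings_lower[OF l end0 i] .
    also have "\<dots> \<le> int K" using l i labelings_range by (auto simp: strict_labelings_def)
    finally show ?thesis using K(1) by (simp add: multichains_def)
  qed
  have small: "small_interval_chain P c \<and> length c = ?n" if c: "c \<in> C" for c
  proof -
    have cm: "c \<in> multichains P ?T k" "\<forall>t<k. small_step (c ! t) (c ! Suc t)"
      using c by (auto simp: C_def)
    then obtain l where l: "l \<in> strict_labelings P ?T k" and cl: "c = chain_of_labeling P ?T k l"
      using labeling by blast
    have l': "l \<in> labelings P ?T k" using l by (simp add: strict_labelings_def)
    have "c ! t \<noteq> c ! Suc t" if t: "t < k" for t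
    proof -
      obtain i where i: "(i, int t + 2) \<in> cells P ?T" "int ?n + 2 \<le> int i + (int t + 2)"
        using zig[of "int t + 2"] t n by auto
      have "l (i, int t + 2) = int t + 1"
        using strict_labelings_lower[OF l end0 i]
          strict_labelings_upper[OF l[unfolded k_def] end0 i(1)] by linarith
      then have "(i, int t + 2) \<in> cells (c ! t) (c ! Suc t)"
        using cells_snapshot_Suc[OF l' le] i t by (simp add: cl)
      then show ?thesis by (auto simp: cells_iff)
    qed
    then show ?thesis using cm n unfolding small_interval_chain_iff by (auto simp: multichains_def)
  qed
  have ex: "C \<noteq> {}"
  proof -
    define l where "l = restrict (\<lambda>(i, h). h - 1) (cells P ?T)"
    have "2 \<le> h \<and> h \<le> int ?n" if c: "(i, h) \<in> cells P ?T" for i h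
      using cell_height_ge[OF c] cell_index_pos[OF c] pos[of i] end0 c
      by (cases "i = ?n") (auto simp: cells_top_iff)
    then have l: "l \<in> labelings P ?T k"
      unfolding labelings_def by (force simp: l_def n)
    have "l \<in> strict_labelings P ?T k"
      using l by (simp add: strict_labelings_def) (simp add: l_def)
    then have "chain_of_labeling P ?T k l \<in> C"
      using chain_of_labeling_in_multichains[OF l le] small_steps_iff_strict[OF l le]
      by (simp add: C_def)
    then show ?thesis by blast
  qed
  have "{c. small_interval_chain P c \<and> (\<forall>c'. small_interval_chain P c' \<longrightarrow> length c \<le> length c')} = C"
  proof (intro equalityI subsetI)
    fix c assume "c \<in> C"
    then show "c \<in> {c. small_interval_chain P c \<and> (\<forall>c'. small_interval_chain P c' \<longrightarrow> length c \<le> length c')}"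
      using small min by auto
  next
    fix c
    assume "c \<in> {c. small_interval_chain P c \<and> (\<forall>c'. small_interval_chain P c' \<longrightarrow> length c \<le> length c')}"
    then have c: "small_interval_chain P c" "\<And>c'. small_interval_chain P c' \<Longrightarrow> length c \<le> length c'"
      by auto
    obtain c0 where "small_interval_chain P c0" "length c0 = ?n" using ex small by blast
    then have "length c = ?n" using c(2) min[OF c(1)] by fastforce
    moreover obtain K where K: "c \<in> multichains P ?T K" "\<forall>t<K. small_step (c ! t) (c ! Suc t)"
      using c(1) by (auto simp: small_interval_chain_iff)
    ultimately have "K = k" using n by (simp add: multichains_def)
    then show "c \<in> C" using K by (simp add: C_def)
  qed
  then have "num_min_chains P = card C" by (simp add: num_min_chains_def)
  also have "\<dots> = card {l \<in> labelings P ?T k. l \<in> strict_labelings P ?T k}"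
    unfolding C_def
    by (rule card_multichains_eq_card_labelings[OF le,
          where F = "\<lambda>c. \<forall>t<k. small_step (c ! t) (c ! Suc t)"])
       (rule small_steps_iff_strict[OF _ le])
  also have "{l \<in> labelings P ?T k. l \<in> strict_labelings P ?T k} = strict_labelings P ?T k"
    by (auto simp: strict_labelings_def)
  finally show ?thesis by (simp add: k_def)
qed

section \<open>Elevated Dyck paths\<close>

lemma height_append: "height (P @ Q) i = height P i + height Q (i - length P)"
  by (simp add: height_def)

lemma height_Cons_Suc: "height (s # P) (Suc i) = step_val s + height P i"
  by (simp add: height_def)

lemma height_elevate: "i \<le> length a \<Longrightarrow> height (U # a @ [D]) (Suc i) = height a i + 1"
  by (simp add: height_Cons_Suc height_append)

lemma height_elevate_end:
  "dyck a \<Longrightarrow> height (U # a @ [D]) (Suc (Suc (length a))) = 0"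
  by (simp add: height_Cons_Suc height_append dyck_def) (simp add: height_def)

definition pyramid :: "nat \<Rightarrow> path" where
  "pyramid n = replicate (n div 2) U @ replicate (n div 2) D"

lemma length_pyramid [simp]: "even n \<Longrightarrow> length (pyramid n) = n"
  by (auto simp: pyramid_def elim: evenE)

lemma height_pyramid:
  assumes "even n" "i \<le> n"
  shows "height (pyramid n) i = min (int i) (int n - int i)"
proof -
  obtain m where m: "n = 2 * m" using assms(1) by (rule evenE)
  have "height (replicate k s) j = int (min j k) * step_val s" for k j s
    by (simp add: height_def sum_list_replicate)
  then show ?thesis using assms(2) by (auto simp: pyramid_def m height_append min_def of_nat_diff)
qed

lemma dyck_even_length: "dyck a \<Longrightarrow> even (length a)"
  using height_parity[of "length a" a] by (simp add: dyck_def)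

lemma dyck_le_pyramid:
  assumes "dyck a"
  shows "a \<le>\<^sub>P pyramid (length a)"
proof -
  have "height a i \<le> int (length a) - int i" if "i \<le> length a" for i
    using height_descent[of i "length a - i" a] assms that by (simp add: dyck_def of_nat_diff)
  then show ?thesis
    using dyck_even_length[OF assms] height_le_index by (simp add: path_le_iff height_pyramid)
qed

lemma dyck_between:
  assumes "dyck a" "a \<le>\<^sub>P P" "P \<le>\<^sub>P pyramid (length a)"
  shows "dyck P"
proof -
  have len: "length P = length a" using assms(2) by (simp add: path_le_iff)
  have "height P (length a) \<le> 0"
    using assms(3) dyck_even_length[OF assms(1)] by (auto simp: path_le_iff height_pyramid)
  moreover have "0 \<le> height P i" if "i \<le> length a" for i
    using assms(1,2) that by (auto simp: dyck_def path_le_iff intro: order_trans)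
  ultimately show ?thesis using len by (auto simp: dyck_def intro: antisym)
qed

lemma cells_pyramid_iff:
  assumes "dyck a"
  shows "(i, h) \<in> cells a (pyramid (length a)) \<longleftrightarrow>
    i \<le> length a \<and> even (h + int i) \<and> height a i < h \<and> h \<le> int i \<and> int i + h \<le> int (length a)"
  using dyck_even_length[OF assms] by (auto simp: cells_iff height_pyramid)

text \<open>Elevating \<open>a\<close> translates the cells by \<open>(1, 1)\<close>; those below the pyramid become
  the cells outside the region in which \<open>strict_labelings_lower\<close> and
  \<open>strict_labelings_upper\<close> force the label.\<close>

lemma cells_pyramid_iff_elevated:
  assumes "dyck a" and E: "E = U # a @ [D]"
  shows "(i, h) \<in> cells a (pyramid (length a)) \<longleftrightarrow>
    (Suc i, h + 1) \<in> cells E (replicate (length E) U) \<and> int i + h \<le> int (length a)"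
proof (cases "i \<le> length a")
  case True
  then show ?thesis
    using height_elevate[OF True]
    unfolding cells_pyramid_iff[OF assms(1)] cells_top_iff by (auto simp: E)
next
  case False
  have "\<not> (height E (Suc i) < h + 1 \<and> Suc i \<le> length E \<and> int i + h \<le> int (length a))"
  proof
    assume *: "height E (Suc i) < h + 1 \<and> Suc i \<le> length E \<and> int i + h \<le> int (length a)"
    then have "i = Suc (length a)" using False by (simp add: E)
    then show False using * height_elevate_end[OF assms(1)] by (auto simp: E)
  qed
  then show ?thesis using False by (auto simp: cells_iff)
qed

lemma valley_height_le_hv:
  assumes "i \<in> valley_indices a"
  shows "height a i \<le> int (hv a)"
proof -
  have "a \<noteq> []" using assms by (auto simp: valley_indices_def)
  moreover have "finite (snd ` valleys a)"
    by (auto simp: valleys_def intro!: finite_imageI finite_subset[of "valley_indices a" "{..length a}"])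
      (auto simp: valley_indices_def)
  moreover have "height a i \<in> snd ` valleys a" using assms by (force simp: valleys_def)
  ultimately have "height a i \<le> Max (snd ` valleys a)" by simp
  then show ?thesis using \<open>a \<noteq> []\<close> by (simp add: hv_def)
qed

text \<open>The lower bound on the labels is the shear of the condition that labels of the elevated path are
  positive.\<close>

definition sheared_labelings :: "path \<Rightarrow> (nat \<times> int \<Rightarrow> int) set" where
  "sheared_labelings a = {m \<in> labelings a (pyramid (length a)) (hv a + 2).
     \<forall>i h. (i, h) \<in> cells a (pyramid (length a)) \<longrightarrow> int (hv a) + 3 \<le> m (i, h) + h}"

text \<open>The shear \<open>\<phi>\<close> adds \<open>hv a + 2 - h\<close> to the label of a cell at height
  \<open>h\<close>, so strict and weak increase correspond. The bound \<open>h - 1\<close> on strict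
  labels (in the coordinates of the elevated path) becomes the common bound \<open>hv a + 2\<close>.
  The inverse \<open>\<psi>\<close> undoes this and fills in the forced labels to the right of the
  antidiagonal.\<close>

lemma card_strict_labelings_elevated:
  assumes a: "dyck a" and E: "E = U # a @ [D]"
  shows "card (strict_labelings E (replicate (length E) U) (length E - 1)) = card (sheared_labelings a)"
proof -
  let ?T = "replicate (length E) U" and ?N = "length E" and ?C = "cells a (pyramid (length a))"
  let ?K = "int (hv a) + 2"
  note le = dyck_le_pyramid[OF a]
  define \<phi> where "\<phi> l = restrict (\<lambda>(i, h). l (Suc i, h + 1) + ?K - h) ?C" for l :: "nat \<times> int \<Rightarrow> int"
  define \<psi> where "\<psi> m = restrict
      (\<lambda>(i, h). if int i + h \<le> int ?N then m (i - 1, h - 1) - ?K + (h - 1) else h - 1) (cells E ?T)"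
    for m :: "nat \<times> int \<Rightarrow> int"
  have N: "?N = Suc (Suc (length a))" by (simp add: E)
  have end0: "height E ?N = 0" using height_elevate_end[OF a] by (simp add: E)
  note up = strict_labelings_upper[OF _ end0] and low = strict_labelings_lower[OF _ end0]
  note shift = cells_pyramid_iff_elevated[OF a E]
  have EC: "(i - 1, h - 1) \<in> ?C" "1 \<le> i"
    if "(i, h) \<in> cells E ?T" "int i + h \<le> int ?N" for i h
    using that shift[of "i - 1" "h - 1"] cell_index_pos[OF that(1)] by (auto simp: N of_nat_diff)
  have h2: "2 \<le> h" if c: "(i, h) \<in> cells E ?T" for i h
  proof -
    have "0 \<le> height E i"
    proof (cases i)
      case (Suc j)
      then show ?thesis
        using height_elevate[of j a] height_elevate_end[OF a] a c
        by (cases "j \<le> length a") (auto simp: E cells_iff dyck_def not_le le_Suc_eq)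
    qed simp
    then show ?thesis using cell_height_ge[OF c] by simp
  qed
  have "bij_betw \<phi> (strict_labelings E ?T (?N - 1)) (sheared_labelings a)"
  proof (rule bij_betw_byWitness[where f' = \<psi>])
    show "\<forall>l\<in>strict_labelings E ?T (?N - 1). \<psi> (\<phi> l) = l"
    proof
      fix l assume l: "l \<in> strict_labelings E ?T (?N - 1)"
      have "\<psi> (\<phi> l) (i, h) = l (i, h)" if c: "(i, h) \<in> cells E ?T" for i h
      proof (cases "int i + h \<le> int ?N")
        case True
        then show ?thesis using EC[OF c True] c by (simp add: \<psi>_def \<phi>_def)
      next
        case False
        have "even (h + int i)" "even ?N"
          using c dyck_even_length[OF a] by (auto simp: cells_iff N)
        then have "int ?N + 2 \<le> int i + h" using False by presburger
        then show ?thesis using up[OF l c] low[OF l c] False c by (simp add: \<psi>_def)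
      qed
      moreover have "l \<in> extensional (cells E ?T)"
        using l by (auto simp: strict_labelings_def labelings_def PiE_def)
      ultimately show "\<psi> (\<phi> l) = l"
        by (intro extensionalityI[of _ "cells E ?T"]) (auto simp: \<psi>_def)
    qed
    show "\<forall>m\<in>sheared_labelings a. \<phi> (\<psi> m) = m"
    proof
      fix m assume m: "m \<in> sheared_labelings a"
      have "\<phi> (\<psi> m) (i, h) = m (i, h)" if c: "(i, h) \<in> ?C" for i h
        using c shift[of i h] by (simp add: \<psi>_def \<phi>_def N)
      moreover have "m \<in> extensional ?C"
        using m by (auto simp: sheared_labelings_def labelings_def PiE_def)
      ultimately show "\<phi> (\<psi> m) = m"
        by (intro extensionalityI[of _ ?C]) (auto simp: \<phi>_def)
    qed
    have "\<phi> l \<in> sheared_labelings a" if l: "l \<in> strict_labelings E ?T (?N - 1)" for l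
    proof -
      have mono: "\<phi> l (i, h) \<le> \<phi> l (j, h + 1)"
        if ij: "adj i j" and c: "(i, h) \<in> ?C" "(j, h + 1) \<in> ?C" for i j h
      proof -
        have "adj (Suc i) (Suc j)" using ij by (auto simp: adj_def)
        then have "l (Suc i, h + 1) < l (Suc j, h + 1 + 1)"
          using strict_labelingsD(2)[OF l] shift c by blast
        then show ?thesis using c by (simp add: \<phi>_def)
      qed
      have bounds: "\<phi> l (i, h) \<le> int (hv a + 2)" "int (hv a) + 3 \<le> \<phi> l (i, h) + h" if c: "(i, h) \<in> ?C" for i h
      proof -
        have c': "(Suc i, h + 1) \<in> cells E ?T" using shift c by blast
        show "\<phi> l (i, h) \<le> int (hv a + 2)" "int (hv a) + 3 \<le> \<phi> l (i, h) + h"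
          using up[OF l c'] labelings_range[OF strict_labelingsD(1)[OF l] c'] c
          by (auto simp: \<phi>_def)
      qed
      \<comment> \<open>A cell resting on a valley has height at most \<open>hv a + 2\<close>, so there the lower bound is at least
        \<open>1\<close>; all other cells inherit positivity from a cell that they cover.\<close>
      have pos: "1 \<le> \<phi> l (i, h)" if "(i, h) \<in> ?C" for i h
        using that
      proof (induction "nat h" arbitrary: i h rule: less_induct)
        case less
        have "0 < h" using less.prems a by (auto simp: cells_iff dyck_def intro: le_less_trans)
        from lower_cell[OF le less.prems] show ?case
        proof
          assume "i \<in> valley_indices a \<and> h = height a i + 2"
          then show ?thesis using valley_height_le_hv[of i a] bounds(2)[OF less.prems] by auto
        next
          assume "\<exists>j. adj i j \<and> (j, h - 1) \<in> ?C"
          then obtain j where j: "adj i j" "(j, h - 1) \<in> ?C" by blast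
          have "1 \<le> \<phi> l (j, h - 1)" using less.hyps[OF _ j(2)] \<open>0 < h\<close> by simp
          then show ?thesis using mono[OF adj_sym[OF j(1)] j(2)] less.prems by simp
        qed
      qed
      have "\<phi> l \<in> extensional ?C" by (simp add: \<phi>_def)
      then have "\<phi> l \<in> labelings a (pyramid (length a)) (hv a + 2)"
        using pos bounds(1) mono by (rule labelingsI)
      then show ?thesis using bounds(2) by (simp add: sheared_labelings_def)
    qed
    then show "\<phi> ` strict_labelings E ?T (?N - 1) \<subseteq> sheared_labelings a" by blast
    have "\<psi> m \<in> strict_labelings E ?T (?N - 1)" if m: "m \<in> sheared_labelings a" for m
    proof -
      have ml: "m \<in> labelings a (pyramid (length a)) (hv a + 2)"
        and mh: "\<And>i h. (i, h) \<in> ?C \<Longrightarrow> int (hv a) + 3 \<le> m (i, h) + h"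
        using m unfolding sheared_labelings_def by blast+
      have range: "1 \<le> \<psi> m (i, h)" "\<psi> m (i, h) \<le> h - 1" if c: "(i, h) \<in> cells E ?T" for i h
        using labelings_range[OF ml EC(1)[OF c]] mh[OF EC(1)[OF c]] h2[OF c] c
        by (auto simp: \<psi>_def)
      have strict: "\<psi> m (i, h) < \<psi> m (j, h + 1)"
        if ij: "adj i j" and c: "(i, h) \<in> cells E ?T" "(j, h + 1) \<in> cells E ?T" for i j h
      proof (cases "int j + (h + 1) \<le> int ?N")
        case True
        then have True': "int i + h \<le> int ?N" using ij by (auto simp: adj_def)
        have "adj (i - 1) (j - 1)" using ij EC(2)[OF c(1) True'] EC(2)[OF c(2) True] by (auto simp: adj_def)
        then have "m (i - 1, h - 1) \<le> m (j - 1, h - 1 + 1)"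
          using labelings_mono[OF ml _ EC(1)[OF c(1) True']] EC(1)[OF c(2) True] by simp
        then show ?thesis using True True' c by (simp add: \<psi>_def)
      next
        case False
        then show ?thesis using range(2)[OF c(1)] c(2) by (simp add: \<psi>_def)
      qed
      have "\<psi> m (i, h) \<le> int (?N - 1)" if c: "(i, h) \<in> cells E ?T" for i h
        using range(2)[OF c] c[unfolded cells_top_iff] by (simp add: N)
      moreover have "\<psi> m \<in> extensional (cells E ?T)" by (simp add: \<psi>_def)
      ultimately have "\<psi> m \<in> labelings E ?T (?N - 1)"
        using range(1) less_imp_le[OF strict] by (intro labelingsI)
      then show ?thesis using strict by (simp add: strict_labelings_def)
    qed
    then show "\<psi> ` sheared_labelings a \<subseteq> strict_labelings E ?T (?N - 1)" by blast
  qed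
  then show ?thesis by (rule bij_betw_same_card)
qed

section \<open>Multichains of type v\<close>

text \<open>An added cell of minimal height rests on a valley, which it destroys; so if some cell of height at most
  \<open>m + 2\<close> is added, then a valley of height at most \<open>m\<close> disappears. If no
  such cell is added, then all points of height at most \<open>m\<close> stay where they are, and this
  suffices to decide which of them are valleys, since a neighbour of such a point that lies below it is
  itself such a point.\<close>

lemma valleys_upto_eq_iff:
  assumes le: "P \<le>\<^sub>P Q"
  shows "valleys_upto Q m = valleys_upto P m \<longleftrightarrow> (\<forall>i h. (i, h) \<in> cells P Q \<longrightarrow> m + 3 \<le> h)"
proof -
  have len: "length Q = length P" using le by (simp add: path_le_iff)
  have mem: "(i, h) \<in> valleys_upto R m \<longleftrightarrow> i \<in> valley_indices R \<and> h = height R i \<and> h \<le> m" for i h R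
    by (auto simp: valleys_upto_def valleys_def)
  show ?thesis
  proof
    assume eq: "valleys_upto Q m = valleys_upto P m"
    show "\<forall>i h. (i, h) \<in> cells P Q \<longrightarrow> m + 3 \<le> h"
    proof (rule ccontr)
      assume "\<not> ?thesis"
      then have "\<exists>h i. (i, h) \<in> cells P Q \<and> h \<le> m + 2" by auto
      then obtain h0 i0 where c0: "(i0, h0) \<in> cells P Q" "h0 \<le> m + 2" by blast
      have "False" if "(i, h) \<in> cells P Q" "h \<le> m + 2" for i h
        using that
      proof (induction "nat (h + int (length P))" arbitrary: i h rule: less_induct)
        case less
        have "- int (length P) < h"
        proof -
          have "0 \<le> height P i + int i" using height_descent[of 0 i P] less.prems by (simp add: cells_iff)
          then show ?thesis using less.prems by (auto simp: cells_iff)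
        qed
        from lower_cell[OF le less.prems(1)] show ?case
        proof
          assume v: "i \<in> valley_indices P \<and> h = height P i + 2"
          then have "(i, height P i) \<in> valleys_upto Q m" using less.prems eq mem by auto
          then have "height Q i = height P i" using mem by simp
          then show False using less.prems(1) by (auto simp: cells_iff)
        next
          assume "\<exists>j. adj i j \<and> (j, h - 1) \<in> cells P Q"
          then obtain j where j: "(j, h - 1) \<in> cells P Q" by blast
          show False using less.hyps[OF _ j] less.prems \<open>- int (length P) < h\<close> by simp
        qed
      qed
      then show False using c0 by blast
    qed
  next
    assume high: "\<forall>i h. (i, h) \<in> cells P Q \<longrightarrow> m + 3 \<le> h"
    have eq: "height Q i = height P i" if "i \<le> length P" "height P i \<le> m" for i
    proof (rule ccontr)
      assume ne: "height Q i \<noteq> height P i"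
      have lt: "height P i < height Q i" using ne le that by (auto simp: path_le_iff le_less)
      have par: "even (height P i + int i)" "even (height Q i + int i)"
        using height_parity that len by auto
      then have "height P i + 2 \<le> height Q i" using lt by presburger
      then have "(i, height P i + 2) \<in> cells P Q" using par that by (auto simp: cells_iff)
      then have "m + 3 \<le> height P i + 2" using high by blast
      then show False using that by linarith
    qed
    have nb: "j \<le> length P \<Longrightarrow> adj i j \<Longrightarrow> height P j = height P i + 1 \<longleftrightarrow> height Q j = height Q i + 1"
      if "i \<le> length P" "height Q i = height P i" "height P i \<le> m" for i j
    proof -
      assume j: "j \<le> length P" "adj i j"
      have "height P j = height P i + 1 \<or> height P j = height P i - 1"
        "height Q j = height Q i + 1 \<or> height Q j = height Q i - 1"
        using height_adj[OF j(2), of P] height_adj[OF j(2), of Q] j that len by auto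
      moreover have "height P j \<le> height Q j" using le j by (simp add: path_le_iff)
      moreover have "height Q j = height P j" if "height P j = height P i - 1"
        using eq[of j] j that \<open>height P i \<le> m\<close> by auto
      ultimately show ?thesis using that by auto
    qed
    have "i \<in> valley_indices P \<longleftrightarrow> i \<in> valley_indices Q"
      if "i \<le> length P" "height Q i = height P i" "height P i \<le> m" for i
      using nb[OF that] that len by (auto simp: valley_indices_iff)
    moreover have "height Q i = height P i" if "i \<le> length P" "height P i \<le> m \<or> height Q i \<le> m" for i
    proof -
      have "height P i \<le> height Q i" using le that by (simp add: path_le_iff)
      then show ?thesis using eq[OF that(1)] that(2) by linarith
    qed
    ultimately have "(i, h) \<in> valleys_upto Q m \<longleftrightarrow> (i, h) \<in> valleys_upto P m" for i h
      unfolding mem using len by (metis valley_indices_iff)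
    then show "valleys_upto Q m = valleys_upto P m" by auto
  qed
qed

lemma valleys_upto_mono:
  "valleys_upto P m = valleys_upto Q m \<Longrightarrow> k \<le> m \<Longrightarrow> valleys_upto P k = valleys_upto Q k"
  unfolding valleys_upto_def set_eq_iff by fastforce

text \<open>Comparing neighbours in the multichain is the same as comparing with its first path, because the
  condition at \<open>j\<close> concerns fewer heights than all earlier conditions.\<close>

lemma same_low_valleys_iff:
  assumes P0: "\<sigma> 0 = P" and step: "\<And>t. t < k \<Longrightarrow> \<sigma> t \<le>\<^sub>P \<sigma> (Suc t)"
  shows "(\<forall>j\<in>{1..k}. valleys_upto (\<sigma> j) (int k - int j) = valleys_upto (\<sigma> (j - 1)) (int k - int j))
    \<longleftrightarrow> (\<forall>t\<le>k. \<forall>i h. (i, h) \<in> cells P (\<sigma> t) \<longrightarrow> int k + 3 \<le> int t + h)"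
    (is "?V \<longleftrightarrow> ?C")
proof -
  have ge: "P \<le>\<^sub>P \<sigma> t" if "t \<le> k" for t
    using that
  proof (induction t)
    case (Suc t)
    then show ?case using path_le_trans[OF _ step] by simp
  qed (simp add: P0)
  have C_iff: "?C \<longleftrightarrow> (\<forall>t\<le>k. valleys_upto (\<sigma> t) (int k - int t) = valleys_upto P (int k - int t))"
    using valleys_upto_eq_iff[OF ge] by (simp add: algebra_simps)
  show ?thesis
  proof
    assume V: ?V
    have "valleys_upto (\<sigma> t) (int k - int t) = valleys_upto P (int k - int t)" if "t \<le> k" for t
      using that
    proof (induction t)
      case (Suc t)
      have "valleys_upto (\<sigma> (Suc t)) (int k - int (Suc t)) = valleys_upto (\<sigma> t) (int k - int (Suc t))"
        using V Suc.prems by (auto dest: bspec[of _ _ "Suc t"])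
      also have "\<dots> = valleys_upto P (int k - int (Suc t))"
        by (rule valleys_upto_mono[of _ "int k - int t"]) (use Suc in auto)
      finally show ?case .
    qed (simp add: P0)
    then show ?C using C_iff by blast
  next
    assume ?C
    then have eq: "valleys_upto (\<sigma> t) (int k - int t) = valleys_upto P (int k - int t)" if "t \<le> k" for t
      using C_iff that by blast
    show ?V
    proof
      fix j assume j: "j \<in> {1..k}"
      have "valleys_upto (\<sigma> (j - 1)) (int k - int j) = valleys_upto P (int k - int j)"
        by (rule valleys_upto_mono[OF eq]) (use j in auto)
      then show "valleys_upto (\<sigma> j) (int k - int j) = valleys_upto (\<sigma> (j - 1)) (int k - int j)"
        using eq[of j] j by simp
    qed
  qed
qed

text \<open>The summand of the formula at \<open>s\<close> counts the pairs whose multichain ends in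
  \<open>s\<close>.\<close>

definition v_pairs :: "path \<Rightarrow> (path list \<times> path) set" where
  "v_pairs a = {(\<sigma>, Q). type_v \<sigma> \<and> hd \<sigma> = a \<and> last \<sigma> \<le>\<^sub>P Q \<and> Q \<le>\<^sub>P pyramid (length a)}"

text \<open>The lower bound on sheared labels in terms of paths. At the last two indices it holds for any multichain
  that starts at a Dyck path, so it restricts only the part of type \<open>v\<close>.\<close>

definition low_valleys_kept :: "path \<Rightarrow> path list \<Rightarrow> bool" where
  "low_valleys_kept a c \<longleftrightarrow> (\<forall>t\<le>hv a + 2. \<forall>i h. (i, h) \<in> cells a (pyramid (length a)) \<longrightarrow>
     h \<le> height (c ! t) i \<longrightarrow> int (hv a) + 3 \<le> int t + h)"

lemma card_sheared_labelings:
  assumes "dyck a"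
  shows "card (sheared_labelings a) =
    card {c \<in> multichains a (pyramid (length a)) (hv a + 2). low_valleys_kept a c}"
  unfolding sheared_labelings_def
proof (rule card_multichains_eq_card_labelings[OF dyck_le_pyramid[OF assms],
      where F = "low_valleys_kept a", symmetric])
  let ?T = "pyramid (length a)" and ?k = "hv a + 2"
  fix l assume l: "l \<in> labelings a ?T ?k"
  have th: "h \<le> height (chain_of_labeling a ?T ?k l ! t) i \<longleftrightarrow> l (i, h) \<le> int t"
    if "(i, h) \<in> cells a ?T" "t \<le> ?k" for i h t
    using cell_below_snapshot_iff[OF l dyck_le_pyramid[OF assms] that(1)] that(2) by simp
  show "low_valleys_kept a (chain_of_labeling a ?T ?k l) \<longleftrightarrow>
      (\<forall>i h. (i, h) \<in> cells a ?T \<longrightarrow> int (hv a) + 3 \<le> l (i, h) + h)"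
  proof
    assume L: "low_valleys_kept a (chain_of_labeling a ?T ?k l)"
    show "\<forall>i h. (i, h) \<in> cells a ?T \<longrightarrow> int (hv a) + 3 \<le> l (i, h) + h"
    proof (intro allI impI)
      fix i h assume c: "(i, h) \<in> cells a ?T"
      have "nat (l (i, h)) \<le> ?k" "int (nat (l (i, h))) = l (i, h)"
        using labelings_range[OF l c] by auto
      then show "int (hv a) + 3 \<le> l (i, h) + h"
        using L c th[OF c, of "nat (l (i, h))"] unfolding low_valleys_kept_def by (metis order_refl)
    qed
  next
    assume "\<forall>i h. (i, h) \<in> cells a ?T \<longrightarrow> int (hv a) + 3 \<le> l (i, h) + h"
    then show "low_valleys_kept a (chain_of_labeling a ?T ?k l)"
      using th unfolding low_valleys_kept_def by fastforce
  qed
qed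

text \<open>Membership of the \<open>\<sigma>\<^sub>j\<close> in the Dyck paths is automatic between \<open>a\<close>
  and the pyramid, and the valley condition of type \<open>v\<close> becomes the cell condition by
  \<open>same_low_valleys_iff\<close>.\<close>

lemma v_pairs_iff:
  assumes a: "dyck a" and len: "length \<sigma> = Suc (hv a)"
  shows "(\<sigma>, Q) \<in> v_pairs a \<longleftrightarrow>
    \<sigma> @ [Q, pyramid (length a)] \<in> multichains a (pyramid (length a)) (hv a + 2) \<and>
    low_valleys_kept a (\<sigma> @ [Q, pyramid (length a)])"
proof -
  let ?T = "pyramid (length a)" and ?h = "hv a"
  define c where "c = \<sigma> @ [Q, ?T]"
  have nth: "t \<le> ?h \<Longrightarrow> c ! t = \<sigma> ! t" "c ! Suc ?h = Q" "c ! Suc (Suc ?h) = ?T" for t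
    using len by (auto simp: c_def nth_append)
  have \<sigma>: "hd \<sigma> = \<sigma> ! 0" "last \<sigma> = \<sigma> ! ?h"
    using len by (auto simp: hd_conv_nth last_conv_nth simp flip: length_greater_0_conv)
  have all_less: "(\<forall>t<?h + 2. R t) \<longleftrightarrow> (\<forall>t<?h. R t) \<and> R ?h \<and> R (Suc ?h)" for R
    by (auto simp: less_Suc_eq)
  have mult: "c \<in> multichains a ?T (?h + 2) \<longleftrightarrow> \<sigma> ! 0 = a \<and>
      (\<forall>t<?h. \<sigma> ! t \<le>\<^sub>P \<sigma> ! Suc t) \<and> \<sigma> ! ?h \<le>\<^sub>P Q \<and> Q \<le>\<^sub>P ?T"
    using len nth unfolding multichains_def mem_Collect_eq all_less by (auto simp: c_def)
  have tr: "transp (\<le>\<^sub>P)" by (rule transpI) (rule path_le_trans)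
  have sorted: "sorted_wrt (\<le>\<^sub>P) \<sigma> \<longleftrightarrow> (\<forall>t<?h. \<sigma> ! t \<le>\<^sub>P \<sigma> ! Suc t)"
    using len by (simp add: sorted_wrt_iff_nth_Suc_transp[OF tr])
  show ?thesis
  proof (cases "c \<in> multichains a ?T (?h + 2)")
    case False
    then show ?thesis
      using \<sigma> mult sorted by (auto simp: v_pairs_def type_v_def simp flip: c_def)
  next
    case True
    note m = True[unfolded mult]
    have le: "a \<le>\<^sub>P c ! t" "c ! t \<le>\<^sub>P ?T" if "t \<le> ?h + 2" for t
      using multichains_between[OF True that] .
    have "dyck s" if s: "s \<in> set \<sigma>" for s
    proof -
      obtain t where "t < length \<sigma>" "s = \<sigma> ! t"
        using s unfolding in_set_conv_nth by blast
      then have "t \<le> ?h" "s = c ! t" using len nth(1)[of t] by auto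
      then show ?thesis using dyck_between[OF a le[of t]] by simp
    qed
    then have "(\<sigma>, Q) \<in> v_pairs a \<longleftrightarrow> (\<forall>j\<in>{1..?h}.
        valleys_upto (\<sigma> ! j) (int ?h - int j) = valleys_upto (\<sigma> ! (j - 1)) (int ?h - int j))"
      using m len \<sigma> sorted by (auto simp: v_pairs_def type_v_def)
    also have "\<dots> \<longleftrightarrow> (\<forall>t\<le>?h. \<forall>i h. (i, h) \<in> cells a (\<sigma> ! t) \<longrightarrow> int ?h + 3 \<le> int t + h)"
      using same_low_valleys_iff[of "(!) \<sigma>" a ?h] m by simp
    also have "\<dots> \<longleftrightarrow> low_valleys_kept a c"
    proof -
      have "(i, h) \<in> cells a (\<sigma> ! t) \<longleftrightarrow> (i, h) \<in> cells a ?T \<and> h \<le> height (c ! t) i"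
        if "t \<le> ?h" for i h t
        using le[of t] that nth(1)[OF that] by (fastforce simp: cells_iff path_le_iff)
      moreover have "2 \<le> h" if c: "(i, h) \<in> cells a ?T" for i h
        using cell_height_ge[OF c] a c by (fastforce simp: dyck_def cells_iff)
      ultimately show ?thesis
        unfolding low_valleys_kept_def by (smt (verit) add_2_eq_Suc' le_Suc_eq of_nat_Suc)
    qed
    finally show ?thesis using True by (simp add: c_def)
  qed
qed

lemma type_v_length:
  assumes "type_v \<sigma>"
  shows "length \<sigma> = Suc (hv (hd \<sigma>))"
proof -
  have len: "length \<sigma> = Suc (hv (\<sigma> ! 0))" using assms by (simp add: type_v_def)
  then have "\<sigma> \<noteq> []" by auto
  then show ?thesis using len by (simp add: hd_conv_nth)
qed

lemma card_v_pairs: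
  assumes a: "dyck a"
  shows "card (v_pairs a) =
    card {c \<in> multichains a (pyramid (length a)) (hv a + 2). low_valleys_kept a c}"
proof -
  let ?T = "pyramid (length a)"
  let ?f = "\<lambda>(\<sigma>, Q). \<sigma> @ [Q, ?T]"
  have len: "length \<sigma> = Suc (hv a)" if "(\<sigma>, Q) \<in> v_pairs a" for \<sigma> Q
    using that type_v_length by (auto simp: v_pairs_def)
  have "?f ` v_pairs a = {c \<in> multichains a ?T (hv a + 2). low_valleys_kept a c}"
  proof (intro equalityI subsetI)
    fix c assume "c \<in> ?f ` v_pairs a"
    then show "c \<in> {c \<in> multichains a ?T (hv a + 2). low_valleys_kept a c}"
      using v_pairs_iff[OF a len] by auto
  next
    fix c assume c: "c \<in> {c \<in> multichains a ?T (hv a + 2). low_valleys_kept a c}"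
    define \<sigma> where "\<sigma> = take (Suc (hv a)) c"
    have cT: "length c = Suc (Suc (Suc (hv a)))" "c ! Suc (Suc (hv a)) = ?T"
      using c by (auto simp: multichains_def)
    then have "drop (Suc (hv a)) c = [c ! Suc (hv a), ?T]"
      using Cons_nth_drop_Suc[of "Suc (hv a)" c] Cons_nth_drop_Suc[of "Suc (Suc (hv a))" c] by simp
    then have "length \<sigma> = Suc (hv a)" "c = \<sigma> @ [c ! Suc (hv a), ?T]"
      using cT append_take_drop_id[of "Suc (hv a)" c] by (auto simp: \<sigma>_def)
    then show "c \<in> ?f ` v_pairs a"
      using v_pairs_iff[OF a, of \<sigma>] c by force
  qed
  moreover have "inj_on ?f (v_pairs a)" by (auto simp: inj_on_def)
  ultimately show ?thesis using card_image[of ?f "v_pairs a"] by simp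
qed

lemma finite_paths: "finite {P :: path. length P = n}"
  using finite_lists_length_eq[of "{U, D}" n]
  by (rule back_subst[of finite]) (auto simp: set_eq_iff subset_iff intro: step.exhaust)

lemma sum_eq_card_v_pairs:
  assumes a: "dyck a"
  shows "(\<Sum>s\<in>{s. dyck s \<and> length s = length a \<and> a \<le>\<^sub>P s}. num_type_v a s * num_above s) =
    card (v_pairs a)"
proof -
  let ?S = "{s. dyck s \<and> length s = length a \<and> a \<le>\<^sub>P s}"
  define A where "A s = {\<sigma>. type_v \<sigma> \<and> hd \<sigma> = a \<and> last \<sigma> = s}" for s
  define B where "B s = {Q. s \<le>\<^sub>P Q \<and> Q \<le>\<^sub>P pyramid (length s)}" for s
  have lens: "length \<sigma> = Suc (hv a) \<and> (\<forall>p\<in>set \<sigma>. a \<le>\<^sub>P p)"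
    if "type_v \<sigma>" "hd \<sigma> = a" for \<sigma>
  proof -
    have "sorted_wrt (\<le>\<^sub>P) \<sigma>" using that(1) by (simp add: type_v_def)
    then have "\<forall>p\<in>set \<sigma>. a \<le>\<^sub>P p" using that(2) by (cases \<sigma>) auto
    then show ?thesis using type_v_length[OF that(1)] that(2) by simp
  qed
  have finA: "finite (A s)" for s
    by (rule finite_subset[OF _ finite_lists_length_eq[OF finite_paths[of "length a"], of "Suc (hv a)"]])
       (use lens in \<open>fastforce simp: A_def path_le_iff\<close>)
  have finB: "finite (B s)" for s
    by (rule finite_subset[OF _ finite_paths[of "length s"]]) (auto simp: B_def path_le_iff)
  have "(\<Sum>s\<in>?S. num_type_v a s * num_above s) = (\<Sum>s\<in>?S. card (A s \<times> B s))"
    by (simp add: card_cartesian_product A_def B_def num_type_v_def num_above_def pyramid_def)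
  also have "\<dots> = card (\<Union>s\<in>?S. A s \<times> B s)"
  proof (rule card_UN_disjoint[symmetric])
    show "finite ?S" by (rule finite_subset[OF _ finite_paths[of "length a"]]) auto
    show "\<forall>s\<in>?S. \<forall>s'\<in>?S. s \<noteq> s' \<longrightarrow> A s \<times> B s \<inter> A s' \<times> B s' = {}" by (auto simp: A_def)
  qed (use finA finB in simp)
  also have "(\<Union>s\<in>?S. A s \<times> B s) = v_pairs a"
  proof -
    have "last \<sigma> \<in> ?S" if "type_v \<sigma>" "hd \<sigma> = a" for \<sigma>
    proof -
      have "\<sigma> \<noteq> []" using lens[OF that] by auto
      then have "last \<sigma> \<in> set \<sigma>" by simp
      then show ?thesis using lens[OF that] that(1) unfolding type_v_def path_le_iff by simp
    qed
    then show ?thesis by (auto simp: A_def B_def v_pairs_def)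
  qed
  finally show ?thesis .
qed

section \<open>The formula\<close>

theorem proposition2:
  fixes a :: path
  assumes "dyck a"
  shows "num_min_chains (U # a @ [D]) =
    (\<Sum>s\<in>{s. dyck s \<and> length s = length a \<and> a \<le>\<^sub>P s}. num_type_v a s * num_above s)"
proof -
  define E where "E = U # a @ [D]"
  have "num_min_chains E = card (strict_labelings E (replicate (length E) U) (length E - 1))"
  proof (rule num_min_chains_eq_card_strict_labelings)
    show "E \<noteq> []" by (simp add: E_def)
    show "height E (length E) = 0" using height_elevate_end[OF assms] by (simp add: E_def)
    fix i assume "1 \<le> i" "i < length E"
    then obtain j where "i = Suc j" "j \<le> length a" by (cases i) (auto simp: E_def)
    then show "1 \<le> height E i" using height_elevate assms by (simp add: E_def dyck_def)
  qed
  also have "\<dots> = card (sheared_labelings a)"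
    by (rule card_strict_labelings_elevated[OF assms E_def])
  also have "\<dots> = card (v_pairs a)"
    using card_sheared_labelings card_v_pairs assms by simp
  also have "\<dots> = (\<Sum>s\<in>{s. dyck s \<and> length s = length a \<and> a \<le>\<^sub>P s}. num_type_v a s * num_above s)"
    using sum_eq_card_v_pairs[OF assms] by simp
  finally show ?thesis by (simp add: E_def)
qed

end
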